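(* Let $m\ge 2$ and $r\ge 1$ be integers, let $T$ be the perfect rooted $m$-ary tree of depth $r$, and let $t$ be an integer satisfying $1\le t\le 2r$. For each integer $d\ge 0$ let $V_R(d)$ denote the number of vertices in the perfect rooted $m$-ary tree of depth $d$. If $t$ is odd, then \[ P(T,t)= \begin{cases} m^{\frac{t-1}{2}}\left(V_R(r)-V_R\left(\frac{t-1}{2}\right)\right)-\frac{t-1}{2}m^{t-1}, & t\le r,\\ m^{\frac{t-1}{2}}\left(V_R(r)-V_R\left(\frac{t-1}{2}\right)\right)-\left(r-\frac{t-1}{2}\right)m^{t-1}, & t>r, \end{cases} \] and if $t$ is even, then \[ P(T,t)= \begin{cases} \frac{1}{2}(m+1)m^{\frac{t}{2}-1}\left(V_R(r)-V_R\left(\frac{t}{2}-1\right)\right)-\frac{t}{2}m^{t-1}, & t\le r,\\ \frac{1}{2}(m+1)m^{\frac{t}{2}-1}\left(V_R(r)-V_R\left(\frac{t}{2}-1\right)\right)-\left(r-\frac{t}{2}+1\right)m^{t-1}, & t>r. \end{cases} \]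
   Context: A tree $T=(V,E)$ is a finite connected acyclic (simple, undirected) graph. The distance $d_T(u,v)$ between vertices $u,v$ is the number of edges in the unique path in $T$ joining $u$ and $v$. For an integer $t\ge 1$, $P(T,t)$ is the number of unordered pairs $\{u,v\}$ of distinct vertices of $T$ with $d_T(u,v)=t$; equivalently, the number of (undirected) paths of length $t$ in $T$. A rooted $m$-ary tree is a tree with a distinguished vertex $\rho$ of degree $m$, called the root, in which every other vertex has degree $1$ or $m+1$. Its depth $r$ is the maximum of $d_T(\rho,v)$ over all vertices $v$. It is called perfect if and only if every degree-$1$ vertex is at distance $r$ from $\rho$. For each $r\ge 1$ there is, up to isomorphism, exactly one perfect rooted $m$-ary tree of depth $r$ (it has exactly $m^s$ vertices at distance $s$ from $\rho$ for each $0\le s\le r$); by convention, the perfect rooted $m$-ary tree of depth $0$ is the single-vertex tree consisting of the root, so $V_R(0)=1$. *)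

theory Defs
  imports Complex_Main "Graph_Theory.Graph_Theory"
begin

text \<open>
  A finite simple undirected graph is a \<^locale>\<open>pair_graph\<close>, that is, a finite, loop-free,
  symmetric set of arcs; the edge joining \<open>u\<close> and \<open>v\<close> is the pair of arcs \<open>(u, v)\<close>, \<open>(v, u)\<close>.
  The predicate \<open>tree\<close> of the Graph_Theory library is unsuitable here: it is about directed cycles,
  so \<open>(u, v)\<close>, \<open>(v, u)\<close> would count as a cycle. Cycles of an undirected simple graph are the
  library cycles of length at least 3.
\<close>

definition undirected_tree :: "'a pair_pre_digraph \<Rightarrow> bool" where
  "undirected_tree T \<longleftrightarrow> pair_graph T \<and> connected (with_proj T) \<and>
     \<not> (\<exists>c. pre_digraph.cycle (with_proj T) c \<and> 3 \<le> length c)"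

text \<open>A path is given by its list of arcs, so its length is its number of edges.\<close>

definition tree_dist :: "'a pair_pre_digraph \<Rightarrow> 'a \<Rightarrow> 'a \<Rightarrow> nat" where
  "tree_dist T u v = length (THE p. pre_digraph.apath (with_proj T) u p v)"

definition num_pairs_at_dist :: "'a pair_pre_digraph \<Rightarrow> nat \<Rightarrow> nat" where
  "num_pairs_at_dist T t =
     card {{u, v} | u v. u \<in> pverts T \<and> v \<in> pverts T \<and> u \<noteq> v \<and> tree_dist T u v = t}"

text \<open>By symmetry, the out-degree is the degree in the undirected graph.\<close>

abbreviation vertex_degree :: "'a pair_pre_digraph \<Rightarrow> 'a \<Rightarrow> nat" where
  "vertex_degree T v \<equiv> out_degree (with_proj T) v"

definition rooted_mary_tree :: "nat \<Rightarrow> 'a pair_pre_digraph \<Rightarrow> 'a \<Rightarrow> bool" where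
  "rooted_mary_tree m T \<rho> \<longleftrightarrow> undirected_tree T \<and> \<rho> \<in> pverts T \<and> vertex_degree T \<rho> = m \<and>
     (\<forall>v \<in> pverts T - {\<rho>}. vertex_degree T v = 1 \<or> vertex_degree T v = m + 1)"

definition tree_depth :: "'a pair_pre_digraph \<Rightarrow> 'a \<Rightarrow> nat" where
  "tree_depth T \<rho> = Max (tree_dist T \<rho> ` pverts T)"

text \<open>
  The single-vertex tree is not a rooted \<open>m\<close>-ary tree (its root has degree 0); it is the perfect
  tree of depth 0 by convention.
\<close>

definition perfect_mary_tree :: "nat \<Rightarrow> nat \<Rightarrow> 'a pair_pre_digraph \<Rightarrow> 'a \<Rightarrow> bool" where
  "perfect_mary_tree m r T \<rho> \<longleftrightarrow>
     (if r = 0 then pverts T = {\<rho>} \<and> parcs T = {}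
      else rooted_mary_tree m T \<rho> \<and> tree_depth T \<rho> = r \<and>
        (\<forall>v \<in> pverts T. vertex_degree T v = 1 \<longrightarrow> tree_dist T \<rho> v = r))"

text \<open>
  Perfect trees of given depth are unique up to isomorphism, so their number of vertices is well
  defined. The vertices are taken in \<^typ>\<open>nat\<close> because every finite graph has a copy there.
\<close>

definition V_R :: "nat \<Rightarrow> nat \<Rightarrow> nat" where
  "V_R m d = (THE n. \<exists>(T :: nat pair_pre_digraph) \<rho>. perfect_mary_tree m d T \<rho> \<and> card (pverts T) = n)"

end

theory Submission
  imports Defs
begin

text \<open>
  The proof counts ordered pairs \<open>(u, v)\<close> at distance \<open>t\<close> by their lowest common ancestor \<open>w\<close>. The path
  from \<open>u\<close> to \<open>v\<close> climbs \<open>a\<close> edges to \<open>w\<close> and then descends \<open>t - a\<close> edges to \<open>v\<close>; the pair determines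
  \<open>a\<close> and \<open>w\<close>. If \<open>w\<close> has depth at most \<open>r - max a (t - a)\<close>, all descendants of \<open>w\<close> at the two relative
  depths are present, and the pairs with apex \<open>w\<close> number \<open>m ^ t\<close> if \<open>a = 0\<close> or \<open>a = t\<close>, and
  \<open>m ^ t - m ^ (t - 1)\<close> otherwise, because then \<open>u\<close> and \<open>v\<close> must lie below different children of \<open>w\<close>.
  If \<open>w\<close> is deeper, there are none. Writing
  \<open>G n = 1 + m + \<dots> + m ^ (n - 1)\<close> for the number of vertices of depth less than \<open>n\<close>, this gives
  \<open>2 * P(T, t) = (\<Sum>a\<le>t. f (max a (t - a)))\<close>, where \<open>f b\<close> is \<open>G (r + 1 - b)\<close> times the appropriate one
  of the two numbers when \<open>b \<le> r\<close>, and \<open>0\<close> when \<open>b > r\<close> (lemma \<open>twice_num_pairs_at_dist\<close>).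

  The recurrence \<open>G (n + 1) = m * G n + 1\<close> makes tail sums of \<open>f\<close> telescope:
  \<open>f (j + 1) + \<dots> + f t = m ^ t * G (r - j) - (min (t - 1) r - j) * m ^ (t - 1)\<close> for
  \<open>j \<le> min (t - 1) r\<close> (lemma \<open>sum_split_count\<close>).
  The sum over \<open>a\<close> consists of two such tails. For odd \<open>t = 2 * k + 1\<close> both start at \<open>k + 1\<close>; for even
  \<open>t = 2 * k\<close> one starts at \<open>k + 1\<close> and the other at \<open>k\<close>. The case distinction \<open>t \<le> r\<close> of the result is
  the value of \<open>min (t - 1) r\<close>.

  Two facts connect this computation with graphs given by their arcs. An undirected tree with a chosen
  root carries a parent map and a depth function (lemma \<open>undirected_tree_imp_parent_tree\<close>), in terms of
  which simple paths are unique and have the expected length (lemma \<open>apath_unique_length\<close>). And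
  \<open>V_R m d\<close> is \<open>G (d + 1)\<close> (lemma \<open>V_R_eq_geom_sum\<close>): counting by levels shows that every perfect tree
  has this size, and a perfect tree on natural numbers, numbered like an \<open>m\<close>-ary heap, shows that
  there is one.
\<close>

section \<open>Distances in a tree given by a parent map\<close>

text \<open>
  The value \<open>par \<rho>\<close> is arbitrary: every use of \<open>par\<close> below either excludes the root or
  iterates at most \<open>dep v\<close> times from \<open>v\<close>.
\<close>

locale parent_tree = pair_graph T for T :: "'a pair_pre_digraph" +
  fixes \<rho> :: 'a and par :: "'a \<Rightarrow> 'a" and dep :: "'a \<Rightarrow> nat"
  assumes root_in_verts: "\<rho> \<in> pverts T"
    and dep_root: "dep \<rho> = 0"
    and par_in_verts: "v \<in> pverts T \<Longrightarrow> v \<noteq> \<rho> \<Longrightarrow> par v \<in> pverts T"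
    and dep_par: "v \<in> pverts T \<Longrightarrow> v \<noteq> \<rho> \<Longrightarrow> dep v = Suc (dep (par v))"
    and arc_iff: "(u, v) \<in> parcs T \<longleftrightarrow>
      u \<in> pverts T \<and> v \<in> pverts T \<and> (u \<noteq> \<rho> \<and> par u = v \<or> v \<noteq> \<rho> \<and> par v = u)"
begin

lemma dep_eq_0_iff: "v \<in> pverts T \<Longrightarrow> dep v = 0 \<longleftrightarrow> v = \<rho>"
  using dep_root dep_par by (metis Zero_not_Suc)

lemma ancestor_in_verts:
  assumes "v \<in> pverts T" "a \<le> dep v"
  shows "(par ^^ a) v \<in> pverts T" and "dep ((par ^^ a) v) = dep v - a"
proof -
  from assms have "(par ^^ a) v \<in> pverts T \<and> dep ((par ^^ a) v) = dep v - a"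
  proof (induction a)
    case (Suc a)
    then have IH: "(par ^^ a) v \<in> pverts T" "dep ((par ^^ a) v) = dep v - a" by auto
    with Suc.prems have "(par ^^ a) v \<noteq> \<rho>" using dep_root by auto
    with IH Suc.prems show ?case using par_in_verts dep_par by fastforce
  qed simp
  then show "(par ^^ a) v \<in> pverts T" and "dep ((par ^^ a) v) = dep v - a" by auto
qed

lemma ancestor_root: "v \<in> pverts T \<Longrightarrow> (par ^^ dep v) v = \<rho>"
  using ancestor_in_verts[of v "dep v"] dep_eq_0_iff by auto

text \<open>
  The last conjunct says that the climbs from \<open>u\<close> and \<open>v\<close> meet for the first time after \<open>a\<close> and \<open>b\<close>
  steps, so that their common endpoint is the lowest common ancestor of \<open>u\<close> and \<open>v\<close>.
\<close>

definition meets :: "nat \<Rightarrow> nat \<Rightarrow> 'a \<Rightarrow> 'a \<Rightarrow> bool" where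
  "meets a b u v \<longleftrightarrow> a \<le> dep u \<and> b \<le> dep v \<and> (par ^^ a) u = (par ^^ b) v \<and>
     (a = 0 \<or> b = 0 \<or> (par ^^ (a - 1)) u \<noteq> (par ^^ (b - 1)) v)"

lemma meets_sym: "meets a b u v \<longleftrightarrow> meets b a v u"
  by (auto simp: meets_def)

lemma meets_dep:
  assumes "u \<in> pverts T" "v \<in> pverts T" "meets a b u v"
  shows "dep u + b = dep v + a"
proof -
  have le: "a \<le> dep u" "b \<le> dep v" and eq: "(par ^^ a) u = (par ^^ b) v"
    using assms(3) by (auto simp: meets_def)
  have "dep u - a = dep v - b"
    using ancestor_in_verts(2)[OF assms(1) le(1)] ancestor_in_verts(2)[OF assms(2) le(2)] eq by simp
  then show ?thesis using le by linarith
qed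

lemma meets_self: "u \<in> pverts T \<Longrightarrow> meets a b u u \<Longrightarrow> a = 0 \<and> b = 0"
  using meets_dep[of u u a b] by (auto simp: meets_def)

text \<open>
  A vertex \<open>u \<noteq> v\<close> that is at least as deep as \<open>v\<close> is not an ancestor of \<open>v\<close>, so its climb is not empty. This lemma is the counterpart of \<open>apath_climbs_first\<close> for paths; together they
  let distances be computed by induction on \<open>dep u + dep v\<close>.
\<close>

lemma meets_climb:
  assumes "u \<in> pverts T" "v \<in> pverts T" "u \<noteq> v" "dep v \<le> dep u" "meets a b u v"
  shows "\<exists>a'. a = Suc a' \<and> meets a' b (par u) v"
proof (cases a)
  case 0
  then have "b = 0" using assms(4) meets_dep[OF assms(1,2,5)] by linarith
  with 0 assms(3,5) show ?thesis by (auto simp: meets_def)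
next
  case (Suc a')
  with assms(5) have "u \<noteq> \<rho>" using dep_root by (auto simp: meets_def)
  then have "dep u = Suc (dep (par u))" using assms(1) dep_par by auto
  with assms(5) Suc have "meets a' b (par u) v"
    by (cases a') (auto simp: meets_def funpow_swap1)
  with Suc show ?thesis by auto
qed

lemma meets_exists:
  assumes "u \<in> pverts T" "v \<in> pverts T"
  shows "\<exists>a b. meets a b u v"
proof -
  define k where "k = dep u + dep v"
  have "\<exists>a b. meets a b u v" if "u \<in> pverts T" "v \<in> pverts T" "k = dep u + dep v" "dep v \<le> dep u" for u v
    using that
  proof (induction k arbitrary: u v rule: less_induct)
    case (less k)
    show ?case
    proof (cases "u = v")
      case True
      then show ?thesis by (intro exI[of _ 0]) (auto simp: meets_def)
    next
      case False
      then have ur: "u \<noteq> \<rho>" using less.prems dep_root dep_eq_0_iff by force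
      then have pu: "par u \<in> pverts T" "dep u = Suc (dep (par u))"
        using less.prems par_in_verts dep_par by auto
      have "\<exists>a b. meets a b (par u) v"
      proof (cases "dep v \<le> dep (par u)")
        case True
        then show ?thesis using less.IH[of "dep (par u) + dep v" "par u" v] less.prems pu by auto
      next
        case False
        then have "\<exists>a b. meets a b v (par u)"
          using less.IH[of "dep v + dep (par u)" v "par u"] less.prems pu by auto
        then show ?thesis using meets_sym by blast
      qed
      then obtain a b where ab: "meets a b (par u) v" by auto
      show ?thesis
      \<comment> \<open>If \<open>par u\<close> is an ancestor of \<open>v\<close>, the vertex \<open>u\<close> may be one too; then it is the meeting point itself.\<close>
      proof (cases "b \<noteq> 0 \<and> a = 0 \<and> u = (par ^^ (b - 1)) v")
        case True
        then have "meets 0 (b - 1) u v" using ab by (auto simp: meets_def)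
        then show ?thesis by blast
      next
        case F: False
        have "meets (Suc a) b u v"
          using ab F pu by (cases a) (auto simp: meets_def funpow_swap1)
        then show ?thesis by blast
      qed
    qed
  qed
  from this[of u v] this[of v u] assms show ?thesis
    using meets_sym k_def by (metis add.commute nat_le_linear)
qed

text \<open>
  A simple path that has just gone down from \<open>u\<close> to \<open>c\<close> can continue only to children of \<open>c\<close>, since the
  one other neighbour of \<open>c\<close> is the vertex \<open>u\<close> just left. So it descends all the way to its end.
\<close>

lemma descending_apath:
  assumes "apath u ((u, c) # p) v" "c \<noteq> \<rho>" "par c = u"
  shows "dep u < dep v"
  using assms
proof (induction p arbitrary: u c)
  case Nil
  then show ?case using dep_par[of c] by (auto simp: apath_simps)
next
  case (Cons e p)
  obtain x where e: "e = (c, x)" using Cons.prems(1) by (cases e) (auto simp: apath_simps)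
  have c: "apath c ((c, x) # p) v" "c \<in> pverts T"
    using Cons.prems(1) e by (auto simp: apath_Cons_iff arc_iff)
  have "x \<noteq> u" using Cons.prems(1) e by (cases p) (auto simp: apath_Cons_iff)
  moreover have "(c, x) \<in> parcs T" using c(1) by (auto simp: apath_Cons_iff)
  ultimately have "x \<noteq> \<rho>" "par x = c" using Cons.prems by (auto simp: arc_iff)
  then have "dep c < dep v" using Cons.IH[of c x] c(1) by blast
  moreover have "dep c = Suc (dep u)" using dep_par[of c] Cons.prems c by auto
  ultimately show ?case by simp
qed

lemma apath_climbs_first:
  assumes "apath u p v" "u \<noteq> v" "dep v \<le> dep u"
  shows "\<exists>p'. p = (u, par u) # p' \<and> apath (par u) p' v"
proof (cases p)
  case Nil
  then show ?thesis using assms by (auto simp: apath_simps)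
next
  case (Cons e p')
  obtain c where e: "e = (u, c)" using assms(1) Cons by (cases e) (auto simp: apath_simps)
  have "(u, c) \<in> parcs T" using assms(1) Cons e by (auto simp: apath_Cons_iff)
  moreover have "\<not> (c \<noteq> \<rho> \<and> par c = u)"
    using descending_apath[of u c p' v] assms Cons e by auto
  ultimately have "c = par u" by (auto simp: arc_iff)
  then show ?thesis using assms(1) Cons e by (auto simp: apath_Cons_iff)
qed

lemma apath_in_verts: "apath u p v \<Longrightarrow> u \<in> pverts T \<and> v \<in> pverts T"
  using awalkI_apath awalk_hd_in_verts awalk_last_in_verts by blast

text \<open>
  By \<open>apath_climbs_first\<close> the first arc of a path from the deeper endpoint is forced, and the rest
  is handled by induction. When the other endpoint becomes the deeper one, the path is reversed.
\<close>

lemma apath_unique_length: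
  assumes "apath u p v" "apath u q v" "meets a b u v"
  shows "p = q \<and> length p = a + b"
proof -
  have down: "p = q \<and> length p = a + b"
    if "n = dep u + dep v" "apath u p v" "apath u q v" "meets a b u v" "dep v \<le> dep u" for n u v a b p q
    using that
  proof (induction n arbitrary: u v a b p q rule: less_induct)
    case (less n)
    have V: "u \<in> pverts T" "v \<in> pverts T" using less.prems apath_in_verts by auto
    show ?case
    proof (cases "u = v")
      case True
      then have "p = []" "q = []" using less.prems apath_nonempty_ends by blast+
      then show ?thesis using True meets_self V less.prems by auto
    next
      case False
      obtain p' q' where p: "p = (u, par u) # p'" "apath (par u) p' v"
        and q: "q = (u, par u) # q'" "apath (par u) q' v"
        using apath_climbs_first[of u _ v] False less.prems by metis
      obtain a' where a: "a = Suc a'" "meets a' b (par u) v"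
        using meets_climb V False less.prems by blast
      have "u \<noteq> \<rho>" using a less.prems dep_root by (auto simp: meets_def)
      then have d: "dep u = Suc (dep (par u))" using V dep_par by auto
      have "p' = q' \<and> length p' = a' + b"
      proof (cases "dep v \<le> dep (par u)")
        case True
        then show ?thesis using less.IH[of "dep (par u) + dep v" "par u" v p' q' a' b] less.prems p q a d
          by auto
      next
        case False
        then have "rev_path p' = rev_path q' \<and> length (rev_path p') = b + a'"
          using less.IH[of "dep v + dep (par u)" v "par u" "rev_path p'" "rev_path q'" b a']
            less.prems p q a d meets_sym by auto
        moreover have "length (rev_path p') = length p'" by (induction p') auto
        ultimately show ?thesis by (auto simp: rev_path_eq)
      qed
      then show ?thesis using p q a by auto
    qed
  qed
  show ?thesis
  proof (cases "dep v \<le> dep u")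
    case True
    then show ?thesis using down assms by blast
  next
    case False
    then have "rev_path p = rev_path q \<and> length (rev_path p) = b + a"
      using down[of _ v u "rev_path p" "rev_path q" b a] assms meets_sym by auto
    moreover have "length (rev_path p) = length p" by (induction p) auto
    ultimately show ?thesis by (auto simp: rev_path_eq)
  qed
qed

lemma awalk_to_root: "v \<in> pverts T \<Longrightarrow> \<exists>p. awalk v p \<rho>"
proof (induction "dep v" arbitrary: v)
  case 0
  then have "v = \<rho>" using dep_eq_0_iff by auto
  then show ?case using 0 by (intro exI[of _ "[]"]) (auto simp: awalk_simps)
next
  case (Suc n)
  then have r: "v \<noteq> \<rho>" using dep_root by auto
  then obtain p where "awalk (par v) p \<rho>" using Suc dep_par par_in_verts by force
  then have "awalk v ((v, par v) # p) \<rho>"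
    using r Suc.prems par_in_verts by (auto simp: awalk_simps arc_iff)
  then show ?case by blast
qed

lemma apath_exists:
  assumes "u \<in> pverts T" "v \<in> pverts T"
  shows "\<exists>p. apath u p v"
proof -
  obtain p q where "awalk u p \<rho>" "awalk v q \<rho>" using assms awalk_to_root by blast
  then have "awalk u (p @ rev_path q) v" using awalk_appendI awalk_rev_path by blast
  then show ?thesis using apath_awalk_to_apath by blast
qed

lemma tree_dist_eq:
  assumes "u \<in> pverts T" "v \<in> pverts T" "meets a b u v"
  shows "tree_dist T u v = a + b"
proof -
  obtain p where p: "apath u p v" using apath_exists assms by blast
  then have "(THE p. apath u p v) = p" using apath_unique_length assms by blast
  then show ?thesis using apath_unique_length[OF p p assms(3)] by (simp add: tree_dist_def)
qed

lemma tree_dist_root: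
  assumes "v \<in> pverts T"
  shows "tree_dist T \<rho> v = dep v"
  using tree_dist_eq[of \<rho> v 0 "dep v"] assms root_in_verts ancestor_root by (auto simp: meets_def)

text \<open>
  Removing the first arc \<open>(u, x)\<close> of a cycle leaves a simple path from \<open>x\<close> back to \<open>u\<close>. By uniqueness
  of paths it is the single arc \<open>(x, u)\<close>, so the cycle is an edge traversed back and forth.
\<close>

lemma no_long_cycle:
  assumes "cycle c"
  shows "length c < 3"
proof -
  obtain u where u: "awalk u c u" "distinct (tl (awalk_verts u c))" "c \<noteq> []"
    using assms by (auto simp: cycle_def)
  then obtain x p where c: "c = (u, x) # p" by (cases c) (auto simp: awalk_simps)
  have p: "apath x p u" using u c by (auto simp: apath_def awalk_simps)
  have ux: "(u, x) \<in> parcs T" using u c by (auto simp: awalk_simps)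
  then have "x \<noteq> u" "(x, u) \<in> parcs T" using no_loops' arcs_symmetric by auto
  then have q: "apath x [(x, u)] u" by (auto simp: apath_simps arc_iff)
  have "p = [(x, u)]"
    using apath_unique_length[OF p q] meets_exists[of x u] apath_in_verts[OF p] by blast
  then show ?thesis using c by simp
qed

lemma undirected_tree: "undirected_tree T"
proof -
  have "u \<rightarrow>\<^sup>*\<^bsub>mk_symmetric (with_proj T)\<^esub> v" if "u \<in> pverts T" "v \<in> pverts T" for u v
    using that apath_exists reachable_apath reachable_mk_symmetricI by blast
  then have "connected (with_proj T)"
    using root_in_verts by (auto simp: connected_def strongly_connected_def)
  then show ?thesis
    unfolding undirected_tree_def using no_long_cycle pair_graph by fastforce
qed

definition children :: "'a \<Rightarrow> 'a set" where
  "children v = {c \<in> pverts T. c \<noteq> \<rho> \<and> par c = v}"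

lemma dep_child: "c \<in> children v \<Longrightarrow> dep c = Suc (dep v)"
  using dep_par by (auto simp: children_def)

lemma finite_children: "finite (children v)"
  using pair_finite_verts by (auto simp: children_def)

lemma vertex_degree_eq:
  assumes "v \<in> pverts T"
  shows "vertex_degree T v = card (children v) + (if v = \<rho> then 0 else 1)"
proof -
  let ?P = "if v = \<rho> then {} else {par v}"
  have "out_arcs (with_proj T) v = Pair v ` (children v \<union> ?P)"
    using assms par_in_verts by (auto simp: out_arcs_def children_def arc_iff image_iff)
  then have "vertex_degree T v = card (children v \<union> ?P)"
    by (simp add: out_degree_def card_image inj_on_def)
  also have "\<dots> = card (children v) + card ?P"
  proof (rule card_Un_disjoint)
    show "children v \<inter> ?P = {}"
      using dep_child[of "par v" v] dep_par[of v] assms by (auto simp: children_def)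
  qed (auto simp: finite_children)
  finally show ?thesis by simp
qed

end


section \<open>Counting pairs in a perfect tree by their apex\<close>

definition geom_sum :: "nat \<Rightarrow> nat \<Rightarrow> nat" where
  "geom_sum m n = (\<Sum>i<n. m ^ i)"

lemma geom_sum_Suc: "geom_sum m (Suc n) = m * geom_sum m n + 1"
  unfolding geom_sum_def by (subst sum.lessThan_Suc_shift) (simp add: sum_distrib_left)

lemma geom_sum_0 [simp]: "geom_sum m 0 = 0"
  by (simp add: geom_sum_def)

lemma geom_sum_add: "geom_sum m (n + j) = geom_sum m n + m ^ n * geom_sum m j"
  by (induction j) (simp_all add: geom_sum_def power_add algebra_simps)

locale perfect_parent_tree = parent_tree T \<rho> par dep
  for T :: "'a pair_pre_digraph" and \<rho> par dep +
  fixes m r :: nat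
  assumes dep_le: "v \<in> pverts T \<Longrightarrow> dep v \<le> r"
    and card_children: "v \<in> pverts T \<Longrightarrow> dep v < r \<Longrightarrow> card (children v) = m"
    and m_pos: "0 < m"
begin

definition descendants :: "'a \<Rightarrow> nat \<Rightarrow> 'a set" where
  "descendants w k = {v \<in> pverts T. k \<le> dep v \<and> (par ^^ k) v = w}"

lemma finite_descendants: "finite (descendants w k)"
  using pair_finite_verts by (auto simp: descendants_def)

lemma dep_descendant: "v \<in> descendants w k \<Longrightarrow> dep v = dep w + k"
  using ancestor_in_verts[of v k] by (auto simp: descendants_def)

lemma descendants_Suc: "descendants w (Suc k) = (\<Union>x \<in> descendants w k. children x)"
proof (intro set_eqI iffI)
  fix v assume v: "v \<in> descendants w (Suc k)"
  then have "v \<noteq> \<rho>" "v \<in> pverts T" using dep_root by (auto simp: descendants_def)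
  with v have "par v \<in> descendants w k" "v \<in> children (par v)"
    using par_in_verts dep_par[of v] by (auto simp: descendants_def children_def funpow_swap1)
  then show "v \<in> (\<Union>x \<in> descendants w k. children x)" by blast
next
  fix v assume "v \<in> (\<Union>x \<in> descendants w k. children x)"
  then show "v \<in> descendants w (Suc k)"
    using dep_par[of v] by (auto simp: descendants_def children_def funpow_swap1)
qed

text \<open>Each level below \<open>w\<close>, down to depth \<open>r\<close>, is \<open>m\<close> times as large as the one above it.\<close>

lemma card_descendants:
  assumes "w \<in> pverts T" "dep w + k \<le> r"
  shows "card (descendants w k) = m ^ k"
  using assms
proof (induction k)
  case 0
  then have "descendants w 0 = {w}" by (auto simp: descendants_def)
  then show ?case by simp
next
  case (Suc k)
  have "card (descendants w (Suc k)) = (\<Sum>x \<in> descendants w k. card (children x))"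
    unfolding descendants_Suc
    by (rule card_UN_disjoint) (simp_all add: finite_descendants finite_children, auto simp: children_def)
  also have "\<dots> = (\<Sum>x \<in> descendants w k. m)"
  proof (intro sum.cong refl card_children)
    fix x assume x: "x \<in> descendants w k"
    show "dep x < r" using dep_descendant[OF x] Suc.prems(2) by simp
    show "x \<in> pverts T" using x by (simp add: descendants_def)
  qed
  finally show ?case using Suc by simp
qed

lemma card_level:
  assumes "s \<le> r"
  shows "card {v \<in> pverts T. dep v = s} = m ^ s"
proof -
  have "{v \<in> pverts T. dep v = s} = descendants \<rho> s"
  proof (intro set_eqI iffI)
    fix v assume "v \<in> {v \<in> pverts T. dep v = s}"
    then show "v \<in> descendants \<rho> s" using ancestor_root by (auto simp: descendants_def)
  next
    fix v assume v: "v \<in> descendants \<rho> s"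
    then show "v \<in> {v \<in> pverts T. dep v = s}"
      using dep_descendant[OF v] dep_root by (simp add: descendants_def)
  qed
  then show ?thesis using card_descendants root_in_verts dep_root assms by simp
qed

lemma card_dep_less:
  assumes "n \<le> Suc r"
  shows "card {v \<in> pverts T. dep v < n} = geom_sum m n"
proof -
  have "{v \<in> pverts T. dep v < n} = (\<Union>s<n. {v \<in> pverts T. dep v = s})" by auto
  also have "card \<dots> = (\<Sum>s<n. card {v \<in> pverts T. dep v = s})"
    using pair_finite_verts by (intro card_UN_disjoint) auto
  also have "\<dots> = (\<Sum>s<n. m ^ s)" using assms by (intro sum.cong refl card_level) auto
  finally show ?thesis by (simp add: geom_sum_def)
qed

lemma card_verts: "card (pverts T) = geom_sum m (Suc r)"
proof -
  have "pverts T = {v \<in> pverts T. dep v < Suc r}" using dep_le by (auto simp: less_Suc_eq_le)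
  then show ?thesis using card_dep_less[of "Suc r"] by simp
qed

text \<open>The last conjunct makes \<open>w\<close> the lowest common ancestor of \<open>u\<close> and \<open>v\<close>.\<close>

definition apex_pairs :: "'a \<Rightarrow> nat \<Rightarrow> nat \<Rightarrow> ('a \<times> 'a) set" where
  "apex_pairs w a b = {(u, v). u \<in> descendants w a \<and> v \<in> descendants w b \<and>
     (a = 0 \<or> b = 0 \<or> (par ^^ (a - 1)) u \<noteq> (par ^^ (b - 1)) v)}"

lemma finite_apex_pairs: "finite (apex_pairs w a b)"
  by (rule finite_subset[of _ "descendants w a \<times> descendants w b"])
     (auto simp: apex_pairs_def finite_descendants)

lemma meets_iff_apex_pairs:
  assumes "u \<in> pverts T" "v \<in> pverts T"
  shows "meets a b u v \<longleftrightarrow> (\<exists>w \<in> pverts T. (u, v) \<in> apex_pairs w a b)"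
  using assms ancestor_in_verts(1)[of u a]
  by (auto simp: meets_def apex_pairs_def descendants_def)

lemma descendant_via_child:
  assumes "v \<in> descendants w (Suc k)"
  shows "(par ^^ k) v \<in> children w" and "v \<in> descendants ((par ^^ k) v) k"
proof -
  have v: "v \<in> pverts T" "Suc k \<le> dep v" "par ((par ^^ k) v) = w"
    using assms by (auto simp: descendants_def)
  then have "(par ^^ k) v \<in> pverts T" "dep ((par ^^ k) v) \<noteq> 0"
    using ancestor_in_verts[of v k] by auto
  then show "(par ^^ k) v \<in> children w" using v dep_root by (auto simp: children_def)
  show "v \<in> descendants ((par ^^ k) v) k" using v by (auto simp: descendants_def)
qed

lemma descendants_Suc_child:
  assumes "c \<in> children w" "v \<in> descendants c k"
  shows "v \<in> descendants w (Suc k)"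
  using assms dep_descendant[OF assms(2)] dep_child[OF assms(1)]
  by (auto simp: children_def descendants_def)

text \<open>
  Of the \<open>m ^ a * m ^ b\<close> pairs of descendants of \<open>w\<close>, those below a common child \<open>c\<close> of \<open>w\<close> have to be
  discarded. There are \<open>m ^ (a - 1) * m ^ (b - 1)\<close> of them for each of the \<open>m\<close> children.
\<close>

lemma card_apex_pairs:
  assumes w: "w \<in> pverts T" and a: "dep w + a \<le> r" and b: "dep w + b \<le> r"
  shows "real (card (apex_pairs w a b)) =
    (if a = 0 \<or> b = 0 then real m ^ (a + b) else real m ^ (a + b) - real m ^ (a + b - 1))"
proof (cases "a = 0 \<or> b = 0")
  case True
  then have "apex_pairs w a b = descendants w a \<times> descendants w b" by (auto simp: apex_pairs_def)
  then show ?thesis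
    using True card_descendants[OF w a] card_descendants[OF w b]
    by (simp add: card_cartesian_product power_add)
next
  case False
  then obtain a' b' where ab: "a = Suc a'" "b = Suc b'" by (metis not0_implies_Suc)
  \<comment> \<open>\<open>?S\<close> collects the discarded pairs.\<close>
  let ?S = "\<Union>c \<in> children w. descendants c a' \<times> descendants c b'"
  have S_sub: "?S \<subseteq> descendants w a \<times> descendants w b"
    unfolding ab using descendants_Suc_child by blast
  have eq: "apex_pairs w a b = descendants w a \<times> descendants w b - ?S"
  proof (intro set_eqI iffI)
    fix x assume "x \<in> apex_pairs w a b"
    then have x: "x \<in> descendants w a \<times> descendants w b" "(par ^^ a') (fst x) \<noteq> (par ^^ b') (snd x)"
      using False by (auto simp: apex_pairs_def ab)
    then have "x \<notin> ?S" by (auto simp: descendants_def)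
    with x show "x \<in> descendants w a \<times> descendants w b - ?S" by blast
  next
    fix x assume x: "x \<in> descendants w a \<times> descendants w b - ?S"
    obtain u v where uv: "x = (u, v)" by (cases x)
    have "(par ^^ a') u \<noteq> (par ^^ b') v"
      using x uv descendant_via_child[of u w a'] descendant_via_child[of v w b'] ab by auto
    then show "x \<in> apex_pairs w a b" using x uv ab by (auto simp: apex_pairs_def)
  qed
  have cS: "card ?S = m ^ (a + b - 1)"
  proof -
    have "card ?S = (\<Sum>c \<in> children w. card (descendants c a' \<times> descendants c b'))"
      by (rule card_UN_disjoint) (auto simp: finite_children finite_descendants, auto simp: descendants_def)
    also have "\<dots> = (\<Sum>c \<in> children w. m ^ a' * m ^ b')"
    proof (rule sum.cong[OF refl])
      fix c assume c: "c \<in> children w"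
      then have "c \<in> pverts T" "dep c = Suc (dep w)" using dep_child by (auto simp: children_def)
      then show "card (descendants c a' \<times> descendants c b') = m ^ a' * m ^ b'"
        using a b ab by (simp add: card_cartesian_product card_descendants)
    qed
    also have "\<dots> = m * (m ^ a' * m ^ b')" using card_children[OF w] a ab by simp
    finally show ?thesis by (simp add: ab power_add)
  qed
  have "card (apex_pairs w a b) = card (descendants w a \<times> descendants w b) - card ?S"
    unfolding eq by (rule card_Diff_subset[OF finite_subset[OF S_sub] S_sub]) (auto simp: finite_descendants)
  moreover have "card ?S \<le> card (descendants w a \<times> descendants w b)"
    by (rule card_mono[OF _ S_sub]) (auto simp: finite_descendants)
  moreover have "card (descendants w a \<times> descendants w b) = m ^ (a + b)"
    using card_descendants[OF w a] card_descendants[OF w b] by (simp add: card_cartesian_product power_add)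
  ultimately show ?thesis using cS False by (simp add: of_nat_diff)
qed

text \<open>
  The number of ordered pairs at distance \<open>t\<close> for which the two legs of the path, from the apex to the
  ends, have prescribed lengths with sum \<open>t\<close> and maximum \<open>b\<close>. The first factor counts the possible
  apices; \<open>b = t\<close> means that the other leg is empty.
\<close>

definition split_count :: "nat \<Rightarrow> nat \<Rightarrow> real" where
  "split_count t b = (if b \<le> r
     then real (geom_sum m (Suc r - b)) * (if b = t then real m ^ t else real m ^ t - real m ^ (t - 1))
     else 0)"

lemma card_apex_pairs_Union:
  assumes "a \<le> t" "1 \<le> t"
  shows "real (card (\<Union>w \<in> pverts T. apex_pairs w a (t - a))) = split_count t (max a (t - a))"
proof -
  define b where "b = t - a"
  define x where "x = (if max a b = t then real m ^ t else real m ^ t - real m ^ (t - 1))"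
  have ab: "a + b = t" "(max a b = t) = (a = 0 \<or> b = 0)" using assms by (auto simp: b_def)
  have "card (\<Union>w \<in> pverts T. apex_pairs w a b) = (\<Sum>w \<in> pverts T. card (apex_pairs w a b))"
    using pair_finite_verts
    by (intro card_UN_disjoint) (auto simp: finite_apex_pairs, auto simp: apex_pairs_def descendants_def)
  then have "real (card (\<Union>w \<in> pverts T. apex_pairs w a b)) = (\<Sum>w \<in> pverts T. real (card (apex_pairs w a b)))"
    by simp
  also have "\<dots> = (\<Sum>w \<in> pverts T. if dep w + max a b \<le> r then x else 0)"
  proof (rule sum.cong[OF refl])
    fix w assume w: "w \<in> pverts T"
    show "real (card (apex_pairs w a b)) = (if dep w + max a b \<le> r then x else 0)"
    proof (cases "dep w + max a b \<le> r")
      case True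
      then show ?thesis using card_apex_pairs[OF w, of a b] ab by (simp add: x_def)
    next
      case False
      then have "\<not> dep w + a \<le> r \<or> \<not> dep w + b \<le> r" by (auto simp: max_def split: if_splits)
      then have "descendants w a = {} \<or> descendants w b = {}"
        using dep_descendant dep_le by (metis (no_types, lifting) descendants_def equals0I mem_Collect_eq)
      then have "apex_pairs w a b = {}" by (auto simp: apex_pairs_def)
      then show ?thesis using False by simp
    qed
  qed
  also have "\<dots> = real (card {w \<in> pverts T. dep w + max a b \<le> r}) * x"
    using pair_finite_verts by (simp add: sum.If_cases Int_def)
  also have "\<dots> = split_count t (max a b)"
  proof (cases "max a b \<le> r")
    case True
    then have "{w \<in> pverts T. dep w + max a b \<le> r} = {w \<in> pverts T. dep w < Suc r - max a b}"
      by auto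
    then have "card {w \<in> pverts T. dep w + max a b \<le> r} = geom_sum m (Suc r - max a b)"
      using card_dep_less[of "Suc r - max a b"] by simp
    then show ?thesis using True unfolding split_count_def x_def by (simp del: max.bounded_iff)
  next
    case False
    then have "{w \<in> pverts T. dep w + max a b \<le> r} = {}" by auto
    then have "card {w \<in> pverts T. dep w + max a b \<le> r} = 0" by (metis card.empty)
    then show ?thesis using False by (simp add: split_count_def del: max.bounded_iff)
  qed
  finally show ?thesis by (simp add: b_def)
qed

text \<open>
  Every pair of vertices meets at exactly one apex, which splits the path between them into its two legs.
\<close>

lemma pairs_at_dist_eq:
  assumes "1 \<le> t"
  shows "{(u, v). u \<in> pverts T \<and> v \<in> pverts T \<and> u \<noteq> v \<and> tree_dist T u v = t} =
    (\<Union>a \<le> t. \<Union>w \<in> pverts T. apex_pairs w a (t - a))" (is "?L = ?R")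
proof (intro set_eqI iffI)
  fix x assume "x \<in> ?L"
  then obtain u v where x: "x = (u, v)" "u \<in> pverts T" "v \<in> pverts T" "tree_dist T u v = t" by auto
  then obtain a b where ab: "meets a b u v" using meets_exists by blast
  then have "a + b = t" using tree_dist_eq x by auto
  then have "a \<le> t" "b = t - a" by auto
  then show "x \<in> ?R" using ab meets_iff_apex_pairs[of u v a b] x by auto
next
  fix x assume "x \<in> ?R"
  then obtain a w where aw: "a \<le> t" "w \<in> pverts T" "x \<in> apex_pairs w a (t - a)" by auto
  then obtain u v where x: "x = (u, v)" "a \<le> t" "w \<in> pverts T" "(u, v) \<in> apex_pairs w a (t - a)"
    by (cases x) simp
  then have V: "u \<in> pverts T" "v \<in> pverts T" by (auto simp: apex_pairs_def descendants_def)
  then have M: "meets a (t - a) u v" using meets_iff_apex_pairs x by blast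
  then have "tree_dist T u v = t" using tree_dist_eq[OF V M] x by simp
  moreover have "u \<noteq> v" using M meets_self[of u a "t - a"] V assms by auto
  ultimately show "x \<in> ?L" using x V by auto
qed

lemma tree_dist_sym:
  assumes "u \<in> pverts T" "v \<in> pverts T"
  shows "tree_dist T u v = tree_dist T v u"
proof -
  obtain a b where "meets a b u v" using meets_exists assms by blast
  then show ?thesis using tree_dist_eq[of u v a b] tree_dist_eq[of v u b a] assms meets_sym by auto
qed

end

lemma card_unordered_pairs:
  assumes "finite A" "sym A" "irrefl A"
  shows "2 * card {{u, v} | u v. (u, v) \<in> A} = card A"
proof -
  let ?f = "\<lambda>(u, v). {u, v}"
  have im: "{{u, v} | u v. (u, v) \<in> A} = ?f ` A" by auto
  have fib: "card {p \<in> A. ?f p = e} = 2" if "e \<in> ?f ` A" for e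
  proof -
    obtain u v where e: "e = {u, v}" "(u, v) \<in> A" using \<open>e \<in> ?f ` A\<close> by auto
    then have "u \<noteq> v" "(v, u) \<in> A" using assms by (auto dest: symD irreflD)
    then have "{p \<in> A. ?f p = e} = {(u, v), (v, u)}" using e by (auto simp: doubleton_eq_iff)
    then show ?thesis using \<open>u \<noteq> v\<close> by simp
  qed
  have "card A = (\<Sum>e \<in> ?f ` A. card {p \<in> A. ?f p = e})"
    using sum.image_gen[OF assms(1), of "\<lambda>_. 1::nat" ?f] by simp
  then show ?thesis using fib im by simp
qed

context perfect_parent_tree
begin

lemma twice_num_pairs_at_dist:
  assumes "1 \<le> t"
  shows "2 * real (num_pairs_at_dist T t) = (\<Sum>a\<le>t. split_count t (max a (t - a)))"
proof -
  let ?A = "{(u, v). u \<in> pverts T \<and> v \<in> pverts T \<and> u \<noteq> v \<and> tree_dist T u v = t}"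
  have fin: "finite ?A"
    by (rule finite_subset[of _ "pverts T \<times> pverts T"]) (auto simp: pair_finite_verts)
  have "2 * num_pairs_at_dist T t = card ?A"
    using card_unordered_pairs[OF fin] tree_dist_sym
    by (auto simp: num_pairs_at_dist_def sym_def irrefl_def)
  also have "\<dots> = (\<Sum>a\<le>t. card (\<Union>w \<in> pverts T. apex_pairs w a (t - a)))"
    unfolding pairs_at_dist_eq[OF assms]
  proof (rule card_UN_disjoint)
    show "\<forall>a\<in>{..t}. finite (\<Union>w \<in> pverts T. apex_pairs w a (t - a))"
      using finite_apex_pairs pair_finite_verts by auto
    have "a = a'" if "a \<le> t" "a' \<le> t" "(u, v) \<in> apex_pairs w a (t - a)" "(u, v) \<in> apex_pairs w' a' (t - a')"
      for a a' u v w w'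
    proof -
      have "dep u = dep w + a" "dep v = dep w + (t - a)" "dep u = dep w' + a'" "dep v = dep w' + (t - a')"
        using that(3,4) dep_descendant[of u w a] dep_descendant[of v w "t - a"]
          dep_descendant[of u w' a'] dep_descendant[of v w' "t - a'"] by (simp_all add: apex_pairs_def)
      then show ?thesis using that by linarith
    qed
    then show "\<forall>a\<in>{..t}. \<forall>a'\<in>{..t}. a \<noteq> a' \<longrightarrow>
      (\<Union>w \<in> pverts T. apex_pairs w a (t - a)) \<inter> (\<Union>w \<in> pverts T. apex_pairs w a' (t - a')) = {}"
      by (simp add: disjoint_iff) blast
  qed simp
  finally have "real (2 * num_pairs_at_dist T t) = real (\<Sum>a\<le>t. card (\<Union>w \<in> pverts T. apex_pairs w a (t - a)))"
    by (rule arg_cong)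
  then have "2 * real (num_pairs_at_dist T t) = (\<Sum>a\<le>t. real (card (\<Union>w \<in> pverts T. apex_pairs w a (t - a))))"
    unfolding of_nat_sum of_nat_mult of_nat_numeral .
  also have "\<dots> = (\<Sum>a\<le>t. split_count t (max a (t - a)))"
    using card_apex_pairs_Union assms by (intro sum.cong) auto
  finally show ?thesis .
qed

end


section \<open>Evaluating the sum over the apex positions\<close>

text \<open>
  The maximum is \<open>a\<close> for \<open>a > t div 2\<close> and \<open>t - a\<close> otherwise; the second half is reindexed by \<open>t - a\<close>.
\<close>

lemma sum_max_split:
  fixes f :: "nat \<Rightarrow> real"
  shows "(\<Sum>a\<le>t. f (max a (t - a))) = sum f {t div 2<..t} + sum f {t - t div 2..t}"
proof -
  have "{..t} = {..t div 2} \<union> {t div 2<..t}" by auto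
  then have "(\<Sum>a\<le>t. f (max a (t - a))) =
      (\<Sum>a\<le>t div 2. f (max a (t - a))) + (\<Sum>a \<in> {t div 2<..t}. f (max a (t - a)))"
    by (simp add: sum.union_disjoint disjoint_iff)
  also have "(\<Sum>a \<in> {t div 2<..t}. f (max a (t - a))) = sum f {t div 2<..t}"
    by (intro sum.cong) (auto simp: max_def)
  also have "(\<Sum>a\<le>t div 2. f (max a (t - a))) = sum f {t - t div 2..t}"
  proof (rule sum.reindex_bij_witness[of _ "\<lambda>b. t - b" "\<lambda>a. t - a"])
    fix a assume "a \<in> {..t div 2}"
    then have "max a (t - a) = t - a" by auto
    then show "f (t - a) = f (max a (t - a))" by simp
  qed auto
  finally show ?thesis by simp
qed

context perfect_parent_tree
begin

text \<open>
  Downward induction on \<open>j\<close> from \<open>min (t - 1) r\<close>. For \<open>t \<le> r\<close> the starting sum is the single term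
  \<open>split_count t t\<close>, the one with an empty leg; for \<open>t > r\<close> it is zero, since no leg is
  longer than \<open>r\<close>. Each step adds \<open>G (r - j) * (m ^ t - m ^ (t - 1))\<close>, where \<open>G\<close> is \<open>geom_sum m\<close>; by the
  recurrence of \<open>G\<close> this is \<open>m ^ t * (G (r - j) - G (r - j - 1)) - m ^ (t - 1)\<close>.
\<close>

lemma sum_split_count:
  assumes "1 \<le> t" "j \<le> min (t - 1) r"
  shows "sum (split_count t) {j<..t} =
    real m ^ t * real (geom_sum m (r - j)) - (real (min (t - 1) r) - real j) * real m ^ (t - 1)"
  using assms(2)
proof (induction j rule: inc_induct)
  case base
  show ?case
  proof (cases "t \<le> r")
    case True
    have "min (t - 1) r = t - 1" "{t - 1<..t} = {t}" "r - (t - 1) = Suc r - t"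
      using assms(1) True by auto
    moreover have "split_count t t = real (geom_sum m (Suc r - t)) * real m ^ t"
      using True by (simp add: split_count_def)
    ultimately show ?thesis by (simp only: sum.insert sum.empty finite.emptyI empty_iff) simp
  next
    case False
    then have "min (t - 1) r = r" by auto
    moreover have "sum (split_count t) {r<..t} = 0"
      by (rule sum.neutral) (auto simp: split_count_def)
    ultimately show ?thesis by simp
  qed
next
  case (step j)
  have j: "Suc j \<le> t - 1" "Suc j \<le> r" using step.hyps by auto
  have "{j<..t} = insert (Suc j) {Suc j<..t}" using j by auto
  then have "sum (split_count t) {j<..t} = split_count t (Suc j) + sum (split_count t) {Suc j<..t}"
    by simp
  also have "split_count t (Suc j) = real (geom_sum m (r - j)) * (real m ^ t - real m ^ (t - 1))"
    using j assms(1) by (auto simp: split_count_def)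
  also have "sum (split_count t) {Suc j<..t} =
    real m ^ t * real (geom_sum m (r - Suc j)) - (real (min (t - 1) r) - real (Suc j)) * real m ^ (t - 1)"
    by (rule step.IH)
  finally have S: "sum (split_count t) {j<..t} =
      real (geom_sum m (r - j)) * (real m ^ t - real m ^ (t - 1)) +
      (real m ^ t * real (geom_sum m (r - Suc j)) - (real (min (t - 1) r) - real (Suc j)) * real m ^ (t - 1))" .
  have G: "real (geom_sum m (r - j)) = real m * real (geom_sum m (r - Suc j)) + 1"
    using geom_sum_Suc[of m "r - Suc j"] j by (simp add: Suc_diff_Suc)
  have P: "real m ^ t = real m * real m ^ (t - 1)"
    using assms(1) by (cases t) auto
  show ?case unfolding S G P by (simp add: algebra_simps)
qed

lemma num_pairs_at_dist_odd:
  assumes "k \<le> r"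
  shows "real (num_pairs_at_dist T (2 * k + 1)) =
    real m ^ k * (real (geom_sum m (Suc r)) - real (geom_sum m (Suc k)))
      - (real (min (2 * k) r) - real k) * real m ^ (2 * k)"
proof -
  have "{k + 1..2 * k + 1} = {k<..2 * k + 1}" by auto
  then have "real (num_pairs_at_dist T (2 * k + 1)) = sum (split_count (2 * k + 1)) {k<..2 * k + 1}"
    using twice_num_pairs_at_dist[of "2 * k + 1"] sum_max_split[of "split_count (2 * k + 1)" "2 * k + 1"]
    by simp
  also have "\<dots> = real m ^ (2 * k + 1) * real (geom_sum m (r - k)) -
      (real (min (2 * k) r) - real k) * real m ^ (2 * k)"
    using sum_split_count[of "2 * k + 1" k] assms by simp
  also have "real m ^ (2 * k + 1) * real (geom_sum m (r - k)) =
      real m ^ k * (real m ^ Suc k * real (geom_sum m (r - k)))"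
    by (simp add: mult_2 power_add)
  also have "real m ^ Suc k * real (geom_sum m (r - k)) = real (geom_sum m (Suc r)) - real (geom_sum m (Suc k))"
    using geom_sum_add[of m "Suc k" "r - k"] assms by simp
  finally show ?thesis .
qed

lemma num_pairs_at_dist_even:
  assumes "1 \<le> k" "k \<le> r"
  shows "real (num_pairs_at_dist T (2 * k)) =
    1 / 2 * (real m + 1) * real m ^ (k - 1) * (real (geom_sum m (Suc r)) - real (geom_sum m k))
      - (real (min (2 * k - 1) r) - real k + 1) * real m ^ (2 * k - 1)"
proof -
  define M where "M = real (min (2 * k - 1) r)"
  define g where "g = real (geom_sum m (r - k))"
  obtain i where i: "k = Suc i" using assms by (cases k) auto
  have "{k..2 * k} = {k - 1<..2 * k}" using assms by auto
  then have "2 * real (num_pairs_at_dist T (2 * k)) =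
      sum (split_count (2 * k)) {k<..2 * k} + sum (split_count (2 * k)) {k - 1<..2 * k}"
    using twice_num_pairs_at_dist[of "2 * k"] sum_max_split[of "split_count (2 * k)" "2 * k"] assms
    by simp
  also have "sum (split_count (2 * k)) {k<..2 * k} = real m ^ (2 * k) * g - (M - real k) * real m ^ (2 * k - 1)"
    using sum_split_count[of "2 * k" k] assms by (simp add: M_def g_def)
  also have "sum (split_count (2 * k)) {k - 1<..2 * k} =
      real m ^ (2 * k) * real (geom_sum m (r - (k - 1))) - (M - real (k - 1)) * real m ^ (2 * k - 1)"
    unfolding M_def by (rule sum_split_count) (use assms in auto)
  also have "real (geom_sum m (r - (k - 1))) = real m * g + 1"
    using geom_sum_Suc[of m "r - k"] assms by (simp add: g_def i Suc_diff_Suc)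
  finally have A: "2 * real (num_pairs_at_dist T (2 * k)) =
      real m ^ (2 * k) * g - (M - real k) * real m ^ (2 * k - 1) +
      (real m ^ (2 * k) * (real m * g + 1) - (M - real (k - 1)) * real m ^ (2 * k - 1))" .
  have B: "real (geom_sum m (Suc r)) - real (geom_sum m k) = real m ^ k * (real m * g + 1)"
    using geom_sum_add[of m k "Suc (r - k)"] geom_sum_Suc[of m "r - k"] assms
    by (simp add: g_def distrib_left)
  have "2 * real (num_pairs_at_dist T (2 * k)) =
      (real m + 1) * real m ^ (k - 1) * (real m ^ k * (real m * g + 1)) -
      2 * (M - real k + 1) * real m ^ (2 * k - 1)"
  proof -
    define x where "x = real m ^ i"
    have "real m ^ (2 * k) = real m * real m * x * x" "real m ^ (2 * k - 1) = real m * x * x"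
      "real m ^ (k - 1) = x" "real m ^ k = real m * x" "real (k - 1) = real k - 1"
      unfolding x_def by (simp_all add: i mult_2 power_add)
    then show ?thesis unfolding A by (simp add: algebra_simps)
  qed
  then have "real (num_pairs_at_dist T (2 * k)) =
      1 / 2 * (real m + 1) * real m ^ (k - 1) * (real m ^ k * (real m * g + 1)) -
      (M - real k + 1) * real m ^ (2 * k - 1)"
    by (simp only: mult.assoc)
  then show ?thesis unfolding B M_def .
qed

end

section \<open>Rooted undirected trees have a parent map\<close>

text \<open>
  The depth of \<open>v\<close> is the length of a shortest walk from the root. Every vertex other than the root has
  a neighbour of smaller depth, namely the last but one vertex of such a walk. No vertex \<open>v\<close> has two
  neighbours \<open>x\<close>, \<open>y\<close> of depth at most \<open>dep v\<close>: shortest walks from the root to \<open>x\<close> and to \<open>y\<close> avoid \<open>v\<close>, so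
  \<open>x\<close> and \<open>y\<close> are joined by a simple path that avoids \<open>v\<close>, and \<open>v\<close> would close it to a cycle. Hence
  one end of each edge is the parent of the other.
\<close>

lemma undirected_tree_imp_parent_tree:
  assumes tree: "undirected_tree T" and root: "\<rho> \<in> pverts T"
  shows "\<exists>par dep. parent_tree T \<rho> par dep"
proof -
  interpret pair_graph T using tree by (simp add: undirected_tree_def)
  have acyclic: "length c < 3" if "cycle c" for c
    using tree that by (auto simp: undirected_tree_def not_le)
  have "strongly_connected (with_proj T)"
    using tree symmetric_connected_imp_strongly_connected pair_sym_arcs by (simp add: undirected_tree_def)
  then have ex_walk: "\<exists>p. awalk \<rho> p v" if "v \<in> pverts T" for v
    using that root reachable_awalk by (auto simp: strongly_connected_def)
  define dep where "dep v = (LEAST n. \<exists>p. awalk \<rho> p v \<and> length p = n)" for v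
  have dep_le: "dep v \<le> length p" if "awalk \<rho> p v" for v p
    unfolding dep_def by (rule Least_le) (use that in blast)
  have shortest: "\<exists>p. awalk \<rho> p v \<and> length p = dep v" if "v \<in> pverts T" for v
    unfolding dep_def by (rule LeastI_ex) (use ex_walk[OF that] in blast)
  have dep_0: "v = \<rho>" if "v \<in> pverts T" "dep v = 0" for v
    using shortest[OF that(1)] that(2) by (auto simp: awalk_Nil_iff)
  have dep_root: "dep \<rho> = 0"
    using dep_le[of "[]" \<rho>] root by (simp add: awalk_Nil_iff)
  have dep_arc: "dep v \<le> Suc (dep u)" if "(u, v) \<in> parcs T" for u v
  proof -
    have "u \<in> pverts T" using that by (rule in_arcsD1)
    then obtain p where p: "awalk \<rho> p u" "length p = dep u" using shortest by blast
    moreover have "awalk u [(u, v)] v" using arc_implies_awalk[OF that] by simp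
    ultimately have "awalk \<rho> (p @ [(u, v)]) v" using awalk_appendI by blast
    then have "dep v \<le> length (p @ [(u, v)])" by (rule dep_le)
    then show ?thesis using p(2) by simp
  qed
  have ex_par: "\<exists>x. (x, v) \<in> parcs T \<and> dep v = Suc (dep x)" if v: "v \<in> pverts T" "v \<noteq> \<rho>" for v
  proof -
    obtain p where p: "awalk \<rho> p v" "length p = dep v" using shortest v by blast
    then have "p \<noteq> []" using v by (auto simp: awalk_Nil_iff)
    then obtain q e where q: "p = q @ [e]" by (cases p rule: rev_cases) auto
    obtain x y where e: "e = (x, y)" by (cases e)
    have x: "awalk \<rho> q x" "(x, v) \<in> parcs T" using p(1) unfolding q e by (auto simp: awalk_simps)
    have "dep x \<le> length q" using dep_le x by blast
    then have "dep v = Suc (dep x)" using dep_arc[OF x(2)] p(2) q by simp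
    with x show ?thesis by blast
  qed
  have avoiding: "\<exists>p. awalk \<rho> p x \<and> z \<notin> set (awalk_verts \<rho> p)"
    if "x \<in> pverts T" "dep x \<le> dep z" "x \<noteq> z" for x z
  proof -
    obtain p where p: "awalk \<rho> p x" "length p = dep x"
      using shortest \<open>x \<in> pverts T\<close> by blast
    have "z \<notin> set (awalk_verts \<rho> p)"
    proof
      assume "z \<in> set (awalk_verts \<rho> p)"
      then obtain q s where qs: "p = q @ s" "awalk \<rho> q z" "awalk z s x"
        using awalk_decomp[OF p(1)] by blast
      have "dep z \<le> length q" using dep_le qs by blast
      moreover have "length q + length s = dep x" using p(2) qs(1) by simp
      ultimately have "length s = 0" using \<open>dep x \<le> dep z\<close> by linarith
      then have "s = []" by simp
      then show False using qs(3) that(3) by (simp add: awalk_Nil_iff)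
    qed
    with p show ?thesis by blast
  qed
  have one_lower: "x = y"
    if arcs: "(v, x) \<in> parcs T" "(v, y) \<in> parcs T" and le: "dep x \<le> dep v" "dep y \<le> dep v" for v x y
  proof (rule ccontr)
    assume "x \<noteq> y"
    have "x \<noteq> v" "y \<noteq> v" "x \<in> pverts T" "y \<in> pverts T"
      using arcs no_loops' in_arcsD2 by blast+
    then obtain p q where p: "awalk \<rho> p x" "v \<notin> set (awalk_verts \<rho> p)"
      and q: "awalk \<rho> q y" "v \<notin> set (awalk_verts \<rho> q)"
      using avoiding le by metis
    let ?w = "rev_path p @ q"
    have w: "awalk x ?w y" using p q awalk_appendI by simp
    have "v \<notin> set (awalk_verts x ?w)"
      using set_awalk_verts_append[of x "rev_path p" \<rho> q y] p q by (simp add: awalk_verts_rev_path)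
    then have v_w: "v \<notin> fst ` set ?w" "v \<notin> snd ` set ?w"
      using set_awalk_verts[OF w] by auto
    define s where "s = awalk_to_apath ?w"
    have s: "apath x s y" "set s \<subseteq> set ?w"
      unfolding s_def using apath_awalk_to_apath[OF w] awalk_to_apath_subset[OF w] by auto
    have sw: "awalk x s y" using s(1) awalkI_apath by blast
    have v_s: "v \<notin> set (awalk_verts x s)"
      using set_awalk_verts[OF sw] s(2) v_w \<open>x \<noteq> v\<close> by auto
    have yv: "awalk y [(y, v)] v" using arc_implies_awalk[of "(y, v)"] arcs arcs_symmetric by simp
    have sv: "awalk x (s @ [(y, v)]) v" using sw yv awalk_appendI by blast
    have "awalk_verts x (s @ [(y, v)]) = awalk_verts x s @ [v]"
      using awalk_verts_append[OF sv] sw by simp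
    then have "distinct (awalk_verts x (s @ [(y, v)]))"
      using s(1) v_s by (simp add: apath_def)
    moreover have "awalk v ((v, x) # s @ [(y, v)]) v"
      using sv arcs unfolding awalk_Cons_iff by simp
    ultimately have "cycle ((v, x) # s @ [(y, v)])"
      unfolding cycle_def by (intro exI[of _ v]) simp
    moreover have "s \<noteq> []" using sw \<open>x \<noteq> y\<close> by (auto simp: awalk_Nil_iff)
    ultimately show False using acyclic[of "(v, x) # s @ [(y, v)]"] by (cases s) auto
  qed
  define par where "par v = (SOME x. (x, v) \<in> parcs T \<and> dep v = Suc (dep x))" for v
  have par: "(par v, v) \<in> parcs T" "dep v = Suc (dep (par v))" if "v \<in> pverts T" "v \<noteq> \<rho>" for v
    using someI_ex[OF ex_par[OF that]] by (simp_all add: par_def)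
  have lower: "u \<noteq> \<rho> \<and> par u = v" if "(u, v) \<in> parcs T" "dep v \<le> dep u" for u v
  proof -
    have V: "u \<in> pverts T" "v \<in> pverts T" "u \<noteq> v" using that in_arcsD1 in_arcsD2 no_loops' by blast+
    then have "u \<noteq> \<rho>" using dep_0 dep_root that(2) by auto
    then show ?thesis
      using one_lower[of u "par u" v] par[of u] V that arcs_symmetric by auto
  qed
  have "parent_tree T \<rho> par dep"
  proof
    show "\<rho> \<in> pverts T" by (rule root)
    show "dep \<rho> = 0" by (rule dep_root)
  next
    fix v assume "v \<in> pverts T" "v \<noteq> \<rho>"
    then show "par v \<in> pverts T" "dep v = Suc (dep (par v))" using par in_arcsD1 by blast+
  next
    fix u v
    show "(u, v) \<in> parcs T \<longleftrightarrow>
      u \<in> pverts T \<and> v \<in> pverts T \<and> (u \<noteq> \<rho> \<and> par u = v \<or> v \<noteq> \<rho> \<and> par v = u)"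
    proof
      assume a: "(u, v) \<in> parcs T"
      then have "u \<in> pverts T" "v \<in> pverts T" using in_arcsD1 in_arcsD2 by blast+
      then show "u \<in> pverts T \<and> v \<in> pverts T \<and> (u \<noteq> \<rho> \<and> par u = v \<or> v \<noteq> \<rho> \<and> par v = u)"
        using lower[OF a] lower[OF arcs_symmetric[OF a]] nat_le_linear by blast
    next
      assume "u \<in> pverts T \<and> v \<in> pverts T \<and> (u \<noteq> \<rho> \<and> par u = v \<or> v \<noteq> \<rho> \<and> par v = u)"
      then show "(u, v) \<in> parcs T" using par arcs_symmetric by blast
    qed
  qed
  then show ?thesis by blast
qed

text \<open>
  A vertex of depth less than \<open>r\<close> is not a leaf, so its degree is \<open>m\<close> or \<open>m + 1\<close> according to whether
  it is the root; in both cases it has \<open>m\<close> children.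
\<close>

lemma perfect_mary_tree_imp_perfect_parent_tree:
  assumes "0 < m" "1 \<le> r" "perfect_mary_tree m r T \<rho>"
  shows "\<exists>par dep. perfect_parent_tree T \<rho> par dep m r"
proof -
  have R: "rooted_mary_tree m T \<rho>" "tree_depth T \<rho> = r"
    and leaf: "\<And>v. v \<in> pverts T \<Longrightarrow> vertex_degree T v = 1 \<Longrightarrow> tree_dist T \<rho> v = r"
    using assms(2,3) by (auto simp: perfect_mary_tree_def)
  then obtain par dep where "parent_tree T \<rho> par dep"
    using undirected_tree_imp_parent_tree[of T \<rho>] unfolding rooted_mary_tree_def by blast
  then interpret parent_tree T \<rho> par dep .
  have "perfect_parent_tree T \<rho> par dep m r"
  proof
    fix v assume v: "v \<in> pverts T"
    have "tree_dist T \<rho> v \<le> tree_depth T \<rho>"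
      unfolding tree_depth_def using v pair_finite_verts by (intro Max_ge) auto
    then show "dep v \<le> r" using R tree_dist_root v by simp
  next
    fix v assume v: "v \<in> pverts T" "dep v < r"
    show "card (children v) = m"
    proof (cases "v = \<rho>")
      case True
      then show ?thesis using vertex_degree_eq[OF v(1)] R by (simp add: rooted_mary_tree_def)
    next
      case False
      have "vertex_degree T v \<noteq> 1" using leaf v tree_dist_root by auto
      then have "vertex_degree T v = m + 1" using R v False by (auto simp: rooted_mary_tree_def)
      then show ?thesis using vertex_degree_eq[OF v(1)] False by simp
    qed
  qed (rule assms)
  then show ?thesis by blast
qed

section \<open>The number of vertices of a perfect tree\<close>

text \<open>
  For \<open>m = 1\<close> the conclusion would fail, because the root would itself be a vertex of degree \<open>1\<close>.
\<close>

lemma (in perfect_parent_tree) perfect_mary_tree: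
  assumes "1 \<le> r" "2 \<le> m"
  shows "perfect_mary_tree m r T \<rho>"
proof -
  have deg: "vertex_degree T v = (if dep v = r then 0 else m) + (if v = \<rho> then 0 else 1)"
    if v: "v \<in> pverts T" for v
  proof -
    have "children v = {}" if "dep v = r"
      using dep_child[of _ v] dep_le that by (auto simp: children_def) (metis Suc_n_not_le_n)
    then show ?thesis using vertex_degree_eq[OF v] card_children[OF v] dep_le[OF v] by auto
  qed
  have "card {v \<in> pverts T. dep v = r} \<noteq> 0" using card_level[of r] m_pos by simp
  then have "\<exists>v \<in> pverts T. dep v = r" by (metis (mono_tags, lifting) Collect_empty_eq card.empty)
  then have "Max (dep ` pverts T) = r"
    using pair_finite_verts dep_le by (intro Max_eqI) auto
  moreover have "tree_dist T \<rho> ` pverts T = dep ` pverts T" using tree_dist_root by auto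
  ultimately have "tree_depth T \<rho> = r" by (simp add: tree_depth_def)
  moreover have "rooted_mary_tree m T \<rho>"
    unfolding rooted_mary_tree_def using undirected_tree root_in_verts deg dep_root assms by auto
  moreover have "\<forall>v \<in> pverts T. vertex_degree T v = 1 \<longrightarrow> tree_dist T \<rho> v = r"
    using deg tree_dist_root \<open>2 \<le> m\<close> by auto
  ultimately show ?thesis using assms by (simp add: perfect_mary_tree_def)
qed

text \<open>
  The vertices are numbered level by level from left to right, as in an array-based heap: the children
  of \<open>v\<close> are \<open>m * v + 1, \<dots>, m * v + m\<close>, and the levels above depth \<open>s\<close> occupy the numbers below
  \<open>geom_sum m s\<close>.
\<close>

definition heap_tree :: "nat \<Rightarrow> nat \<Rightarrow> nat pair_pre_digraph" where
  "heap_tree m d = \<lparr> pverts = {..<geom_sum m (Suc d)},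
     parcs = {(u, v). u < geom_sum m (Suc d) \<and> v < geom_sum m (Suc d) \<and>
       (u \<noteq> 0 \<and> (u - 1) div m = v \<or> v \<noteq> 0 \<and> (v - 1) div m = u)} \<rparr>"

text \<open>
  Everything rests on \<open>geom_sum m (s + 1) = m * geom_sum m s + 1\<close>: it shows that for \<open>v \<noteq> 0\<close> the number \<open>v\<close>
  lies in the first \<open>s + 2\<close> levels exactly if its parent lies in the first \<open>s + 1\<close>.
\<close>

lemma heap_tree_perfect:
  assumes m: "0 < m"
  shows "perfect_parent_tree (heap_tree m d) 0 (\<lambda>v. (v - 1) div m)
    (\<lambda>v. LEAST s. v < geom_sum m (Suc s)) m d"
proof -
  let ?N = "geom_sum m (Suc d)" and ?par = "\<lambda>v::nat. (v - 1) div m"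
    and ?dep = "\<lambda>v. LEAST s. v < geom_sum m (Suc s)"
  have par_less: "v < geom_sum m (Suc (Suc s)) \<longleftrightarrow> ?par v < geom_sum m (Suc s)" if "v \<noteq> 0" for v s
    using that m by (auto simp: geom_sum_Suc[of m "Suc s"] div_less_iff_less_mult mult.commute)
  have par_lt: "?par v < v" if "v \<noteq> 0" for v
    using that m by (metis One_nat_def Suc_pred bot_nat_0.not_eq_extremum div_le_dividend le_imp_less_Suc)
  have ge: "s \<le> geom_sum m s" for s
    using m by (induction s) (auto simp: geom_sum_Suc intro: order_trans)
  have ex: "\<exists>s. v < geom_sum m (Suc s)" for v
    using ge[of "Suc v"] Suc_le_lessD by blast
  have dep_par: "?dep v = Suc (?dep (?par v))" if "v \<noteq> 0" for v
  proof -
    obtain s where "v < geom_sum m (Suc s)" using ex by blast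
    moreover have "\<not> v < geom_sum m (Suc 0)" using that by (simp add: geom_sum_def)
    ultimately have "?dep v = Suc (LEAST s. v < geom_sum m (Suc (Suc s)))"
      by (rule Least_Suc)
    then show ?thesis using par_less[OF that] by simp
  qed
  interpret parent_tree "heap_tree m d" 0 ?par ?dep
  proof
    show "finite (pverts (heap_tree m d))" by (simp add: heap_tree_def)
    show "finite (parcs (heap_tree m d))"
      by (rule finite_subset[of _ "{..<?N} \<times> {..<?N}"]) (auto simp: heap_tree_def)
    show "symmetric (with_proj (heap_tree m d))"
      by (auto simp: symmetric_def heap_tree_def sym_def)
    show "fst e \<noteq> snd e" if "e \<in> parcs (heap_tree m d)" for e
      using that par_lt by (auto simp: heap_tree_def) (metis less_irrefl)+
    show "?par v \<in> pverts (heap_tree m d)" if "v \<in> pverts (heap_tree m d)" "v \<noteq> 0" for v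
      using that par_lt[of v] by (simp add: heap_tree_def)
    show "?dep v = Suc (?dep (?par v))" if "v \<noteq> 0" for v
      using that by (rule dep_par)
    show "?dep 0 = 0" by (rule Least_eq_0) (simp add: geom_sum_def)
  qed (auto simp: heap_tree_def geom_sum_Suc)
  show ?thesis
  proof
    show "?dep v \<le> d" if "v \<in> pverts (heap_tree m d)" for v
      using that by (intro Least_le) (simp add: heap_tree_def)
    show "card (children v) = m" if "v \<in> pverts (heap_tree m d)" "?dep v < d" for v
    proof -
      have "v < geom_sum m (Suc (?dep v))" using LeastI_ex[OF ex] .
      also have "Suc (?dep v) \<le> d" using that(2) by simp
      then have "geom_sum m (Suc (?dep v)) \<le> geom_sum m d"
        unfolding geom_sum_def by (intro sum_mono2) (auto simp del: sum.lessThan_Suc)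
      finally have "m * (v + 1) \<le> m * geom_sum m d" by (intro mult_left_mono) auto
      then have less: "m * v + m < ?N" by (simp add: geom_sum_Suc)
      have par_eq: "c \<noteq> 0 \<and> ?par c = v \<longleftrightarrow> m * v + 1 \<le> c \<and> c \<le> m * v + m" for c
        using m by (cases c) (auto simp: div_nat_eqI dividend_less_times_div Suc_le_eq less_Suc_eq_le add.commute)
      have "children v = {c. c < ?N \<and> (c \<noteq> 0 \<and> ?par c = v)}"
        unfolding children_def by (auto simp: heap_tree_def)
      also have "\<dots> = {m * v + 1..m * v + m}"
        unfolding par_eq using less by auto
      finally show ?thesis by simp
    qed
  qed (rule m)
qed

lemma V_R_eq_geom_sum:
  assumes m: "2 \<le> m"
  shows "V_R m d = geom_sum m (Suc d)"
proof -
  have card: "card (pverts T) = geom_sum m (Suc d)" if "perfect_mary_tree m d T \<rho>"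
    for T :: "nat pair_pre_digraph" and \<rho>
  proof (cases "d = 0")
    case True
    then show ?thesis using that by (simp add: perfect_mary_tree_def geom_sum_def)
  next
    case False
    then have "0 < m" "1 \<le> d" using m by simp_all
    then have "\<exists>par dep. perfect_parent_tree T \<rho> par dep m d"
      by (rule perfect_mary_tree_imp_perfect_parent_tree) (rule that)
    then obtain par dep where "perfect_parent_tree T \<rho> par dep m d" by (elim exE)
    then show ?thesis by (rule perfect_parent_tree.card_verts)
  qed
  have "perfect_mary_tree m d (heap_tree m d) 0"
  proof (cases "d = 0")
    case True
    then show ?thesis by (auto simp: perfect_mary_tree_def heap_tree_def geom_sum_def)
  next
    case False
    then show ?thesis
      using perfect_parent_tree.perfect_mary_tree[OF heap_tree_perfect[of m d]] m by simp
  qed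
  then show ?thesis unfolding V_R_def using card by (intro the_equality) blast+
qed

theorem theorem1p2:
  fixes m r t :: nat and T :: "'a pair_pre_digraph" and \<rho> :: 'a
  assumes "m \<ge> 2" and "r \<ge> 1"
    and "perfect_mary_tree m r T \<rho>"
    and "1 \<le> t" and "t \<le> 2 * r"
  shows "(odd t \<longrightarrow>
      real (num_pairs_at_dist T t) =
        (if t \<le> r
         then real m ^ ((t - 1) div 2) * (real (V_R m r) - real (V_R m ((t - 1) div 2)))
                - real ((t - 1) div 2) * real m ^ (t - 1)
         else real m ^ ((t - 1) div 2) * (real (V_R m r) - real (V_R m ((t - 1) div 2)))
                - (real r - real ((t - 1) div 2)) * real m ^ (t - 1))) \<and>
    (even t \<longrightarrow>
      real (num_pairs_at_dist T t) =
        (if t \<le> r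
         then 1 / 2 * (real m + 1) * real m ^ (t div 2 - 1) * (real (V_R m r) - real (V_R m (t div 2 - 1)))
                - real (t div 2) * real m ^ (t - 1)
         else 1 / 2 * (real m + 1) * real m ^ (t div 2 - 1) * (real (V_R m r) - real (V_R m (t div 2 - 1)))
                - (real r - real (t div 2) + 1) * real m ^ (t - 1)))"
proof -
  obtain par dep where "perfect_parent_tree T \<rho> par dep m r"
    using perfect_mary_tree_imp_perfect_parent_tree[OF _ assms(2,3)] assms(1) by force
  then interpret perfect_parent_tree T \<rho> par dep m r .
  have V: "V_R m d = geom_sum m (Suc d)" for d using V_R_eq_geom_sum assms(1) by simp
  show ?thesis
  proof (intro conjI impI)
    assume "odd t"
    then obtain k where k: "t = 2 * k + 1" by (elim oddE)
    then have kr: "k \<le> r" using assms(5) by simp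
    show "real (num_pairs_at_dist T t) =
        (if t \<le> r
         then real m ^ ((t - 1) div 2) * (real (V_R m r) - real (V_R m ((t - 1) div 2)))
                - real ((t - 1) div 2) * real m ^ (t - 1)
         else real m ^ ((t - 1) div 2) * (real (V_R m r) - real (V_R m ((t - 1) div 2)))
                - (real r - real ((t - 1) div 2)) * real m ^ (t - 1))"
      using num_pairs_at_dist_odd[OF kr] by (auto simp: k V min_def)
  next
    assume "even t"
    then obtain k where k: "t = 2 * k" by (elim evenE)
    then have k1: "1 \<le> k" and kr: "k \<le> r" using assms(4,5) by simp_all
    have "Suc (k - 1) = k" using k1 by simp
    show "real (num_pairs_at_dist T t) =
        (if t \<le> r
         then 1 / 2 * (real m + 1) * real m ^ (t div 2 - 1) * (real (V_R m r) - real (V_R m (t div 2 - 1)))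
                - real (t div 2) * real m ^ (t - 1)
         else 1 / 2 * (real m + 1) * real m ^ (t div 2 - 1) * (real (V_R m r) - real (V_R m (t div 2 - 1)))
                - (real r - real (t div 2) + 1) * real m ^ (t - 1))"
    proof (cases "t \<le> r")
      case True
      then have "real (min (2 * k - 1) r) - real k + 1 = real k" using k k1 by (simp add: min_def of_nat_diff)
      then show ?thesis using num_pairs_at_dist_even[OF k1 kr] True k \<open>Suc (k - 1) = k\<close> by (simp add: V)
    next
      case False
      then have "min (2 * k - 1) r = r" using k by simp
      then show ?thesis using num_pairs_at_dist_even[OF k1 kr] False k \<open>Suc (k - 1) = k\<close> by (simp add: V)
    qed
  qed
qed

end
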